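(* Let $(R_1,\ldots,R_K)$ be a rate-tuple on the Pareto boundary of the region $\mathcal R$ (i.e. a Pareto-optimal element of $\mathcal R$) that is achieved by transmit covariance matrices $\mathbf S_1,\ldots,\mathbf S_K$ with $\mathbf S_k\succeq 0$ and $\mathrm{Tr}(\mathbf S_k)\le P_k$, i.e. $R_k=R_k(\mathbf S_1,\ldots,\mathbf S_K)$ for all $k$. Then the interference-power constraint vector $\boldsymbol\Gamma\ge0$ with entries $$\Gamma_{kj}=\mathbf h_{kj}^H\mathbf S_k\mathbf h_{kj},\qquad k,j\in\{1,\ldots,K\},\ j\ne k,$$ is such that, for every $k\in\{1,\ldots,K\}$, $R_k=C_k(\boldsymbol\Gamma_k)$ and $\mathbf S_k$ is the optimal solution (i.e. is feasible and attains the optimal value) of the problem defining $C_k(\boldsymbol\Gamma_k)$.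
   Context: Setting: the $K$-user multiple-input single-output interference channel (MISO-IC) with interference treated as noise. Transmitter $k$ has $M_k\ge1$ antennas; $\mathbf h_{kj}\in\mathbb C^{M_k\times1}$ is the channel vector from transmitter $k$ to receiver $j$; $\sigma_k^2>0$ is the noise power at receiver $k$; $P_k>0$ is the power budget of transmitter $k$. $\log$ has base 2. For positive semidefinite Hermitian $\mathbf S_k\in\mathbb C^{M_k\times M_k}$ (transmit covariance matrices), the achievable rate of user $k$ is $$R_k(\mathbf S_1,\ldots,\mathbf S_K)=\log\Big(1+\frac{\mathbf h_{kk}^H\mathbf S_k\mathbf h_{kk}}{\sum_{j\ne k}\mathbf h_{jk}^H\mathbf S_j\mathbf h_{jk}+\sigma_k^2}\Big),$$ and the achievable rate region is $$\mathcal R=\bigcup_{\{\mathbf S_k\succeq0\}:\ \mathrm{Tr}(\mathbf S_k)\le P_k,\ k=1,\ldots,K}\big\{(r_1,\ldots,r_K):0\le r_k\le R_k(\mathbf S_1,\ldots,\mathbf S_K),\ k=1,\ldots,K\big\}.$$ A rate-tuple $r\in\mathcal R$ is Pareto optimal if there is no $r'\in\mathcal R$ with $r'\ge r$ componentwise and $r'\ne r$; the Pareto boundary is the set of Pareto-optimal tuples. For non-negative reals $\Gamma_{kj}$ ($k\ne j$), $\boldsymbol\Gamma$ is the vector of all $K(K-1)$ of them, and $\boldsymbol\Gamma_k$ is the vector of the $2(K-1)$ values $\Gamma_{kj},\Gamma_{jk}$, $j\ne k$. $C_k(\boldsymbol\Gamma_k)$ denotes the optimal value of $$\max_{\mathbf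 S_k}\ \log\Big(1+\frac{\mathbf h_{kk}^H\mathbf S_k\mathbf h_{kk}}{\sum_{j\ne k}\Gamma_{jk}+\sigma_k^2}\Big)\quad\text{s.t.}\quad \mathbf h_{kj}^H\mathbf S_k\mathbf h_{kj}\le\Gamma_{kj}\ \forall j\neq k,\quad \mathrm{Tr}(\mathbf S_k)\le P_k,\quad \mathbf S_k\succeq 0 .$$ *)

theory Defs
  imports Complex_Main "Jordan_Normal_Form.Schur_Decomposition"
begin

(* Users are numbered 0, ..., K - 1.  The numbers M k of antennas differ between users, so
   vectors and matrices carry their dimension explicitly.  h k j is the channel vector from
   transmitter k to receiver j, and rate tuples are real vectors of dimension K. *)

definition qform :: "complex mat \<Rightarrow> complex vec \<Rightarrow> complex" where
  "qform A x = conjugate x \<bullet> (A *\<^sub>v x)"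

(* Inequalities on type complex refer to HOL-Library.Complex_Order: 0 \<le> z means that z is
   real and non-negative. *)
definition psd :: "nat \<Rightarrow> complex mat \<Rightarrow> bool" where
  "psd n A \<longleftrightarrow> A \<in> carrier_mat n n \<and> mat_adjoint A = A
     \<and> (\<forall>x \<in> carrier_vec n. 0 \<le> qform A x)"

definition mat_trace :: "complex mat \<Rightarrow> complex" where
  "mat_trace A = (\<Sum>i<dim_row A. A $$ (i, i))"

(* For positive semidefinite S the form qform S h and the trace of S are real; the real parts
   taken here and in the next definition only convert from complex to real. *)
definition rx_power :: "complex mat \<Rightarrow> complex vec \<Rightarrow> real" where
  "rx_power S h = Re (qform S h)"

definition covariance :: "nat \<Rightarrow> real \<Rightarrow> complex mat \<Rightarrow> bool" where
  "covariance n p S \<longleftrightarrow> psd n S \<and> Re (mat_trace S) \<le> p"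

definition rate ::
  "nat \<Rightarrow> (nat \<Rightarrow> nat \<Rightarrow> complex vec) \<Rightarrow> (nat \<Rightarrow> real) \<Rightarrow> (nat \<Rightarrow> complex mat) \<Rightarrow> nat \<Rightarrow> real" where
  "rate K h \<sigma> S k =
     log 2 (1 + rx_power (S k) (h k k)
                / ((\<Sum>j\<in>{..<K} - {k}. rx_power (S j) (h j k)) + (\<sigma> k)\<^sup>2))"

definition rate_region ::
  "nat \<Rightarrow> (nat \<Rightarrow> nat) \<Rightarrow> (nat \<Rightarrow> nat \<Rightarrow> complex vec) \<Rightarrow> (nat \<Rightarrow> real) \<Rightarrow> (nat \<Rightarrow> real)
     \<Rightarrow> real vec set" where
  "rate_region K M h \<sigma> P =
     (\<Union>S \<in> {S. \<forall>k<K. covariance (M k) (P k) (S k)}.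
        {r \<in> carrier_vec K. \<forall>k<K. 0 \<le> r $ k \<and> r $ k \<le> rate K h \<sigma> S k})"

(* The order on real vec is the componentwise one between vectors of equal dimension. *)
definition pareto_optimal :: "real vec set \<Rightarrow> real vec \<Rightarrow> bool" where
  "pareto_optimal X r \<longleftrightarrow> r \<in> X \<and> \<not> (\<exists>r' \<in> X. r \<le> r' \<and> r' \<noteq> r)"

(* The problem of user k for given interference levels \<Gamma>.  Only the entries \<Gamma> k j and
   \<Gamma> j k with j \<noteq> k and j < K occur. *)
definition ic_objective ::
  "nat \<Rightarrow> (nat \<Rightarrow> nat \<Rightarrow> complex vec) \<Rightarrow> (nat \<Rightarrow> real) \<Rightarrow> (nat \<Rightarrow> nat \<Rightarrow> real) \<Rightarrow> nat
     \<Rightarrow> complex mat \<Rightarrow> real" where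
  "ic_objective K h \<sigma> \<Gamma> k S =
     log 2 (1 + rx_power S (h k k) / ((\<Sum>j\<in>{..<K} - {k}. \<Gamma> j k) + (\<sigma> k)\<^sup>2))"

definition ic_feasible ::
  "nat \<Rightarrow> (nat \<Rightarrow> nat) \<Rightarrow> (nat \<Rightarrow> nat \<Rightarrow> complex vec) \<Rightarrow> (nat \<Rightarrow> real) \<Rightarrow> (nat \<Rightarrow> nat \<Rightarrow> real) \<Rightarrow> nat
     \<Rightarrow> complex mat \<Rightarrow> bool" where
  "ic_feasible K M h P \<Gamma> k S \<longleftrightarrow>
     (\<forall>j<K. j \<noteq> k \<longrightarrow> rx_power S (h k j) \<le> \<Gamma> k j) \<and> covariance (M k) (P k) S"

definition ic_capacity ::
  "nat \<Rightarrow> (nat \<Rightarrow> nat) \<Rightarrow> (nat \<Rightarrow> nat \<Rightarrow> complex vec) \<Rightarrow> (nat \<Rightarrow> real) \<Rightarrow> (nat \<Rightarrow> real)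
     \<Rightarrow> (nat \<Rightarrow> nat \<Rightarrow> real) \<Rightarrow> nat \<Rightarrow> real" where
  "ic_capacity K M h \<sigma> P \<Gamma> k =
     (SUP S \<in> {S. ic_feasible K M h P \<Gamma> k S}. ic_objective K h \<sigma> \<Gamma> k S)"

end

theory Submission
  imports Defs
begin

text \<open>
  Replace the covariance matrix of one user \<open>k\<close> by any feasible point of the problem defining
  \<open>C_k\<close>. The constraints say that no other receiver sees more interference from
  transmitter \<open>k\<close> than before, so no other rate drops, while the new rate of user \<open>k\<close> is the
  objective value of that point. If it exceeded the old rate, Pareto optimality would fail.
\<close>

lemma rx_power_nonneg:
  assumes "covariance n p A" and "x \<in> carrier_vec n"
  shows "0 \<le> rx_power A x"
  using assms by (auto simp: covariance_def psd_def rx_power_def less_eq_complex_def)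

lemma interference_pos:
  assumes "\<And>j. j < K \<Longrightarrow> covariance (M j) (P j) (S j)"
    and "\<And>j. j < K \<Longrightarrow> h j k \<in> carrier_vec (M j)"
    and "(\<sigma> k)\<^sup>2 > 0"
  shows "0 < (\<Sum>j\<in>{..<K} - {k}. rx_power (S j) (h j k)) + (\<sigma> k)\<^sup>2"
proof -
  have "0 \<le> (\<Sum>j\<in>{..<K} - {k}. rx_power (S j) (h j k))"
    using assms(1,2) by (auto intro!: sum_nonneg rx_power_nonneg)
  with assms(3) show ?thesis by linarith
qed

text \<open>Both quotients are nonnegative, so both arguments of the logarithm are at least 1.
  Positivity is asked only of the smaller denominator \<open>d\<close>, and \<open>c\<close>
  inherits it.\<close>

lemma log_one_plus_divide_mono:
  fixes a b c d :: real
  assumes "0 \<le> a" "a \<le> b" "0 < d" "d \<le> c"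
  shows "log 2 (1 + a / c) \<le> log 2 (1 + b / d)"
proof -
  have "a / c \<le> b / d" using assms by (intro frac_le) auto
  moreover have "0 \<le> a / c" using assms by simp
  ultimately show ?thesis by simp
qed

lemma rate_nonneg:
  assumes "\<And>j. j < K \<Longrightarrow> covariance (M j) (P j) (S j)"
    and "\<And>j. j < K \<Longrightarrow> h j k \<in> carrier_vec (M j)"
    and "(\<sigma> k)\<^sup>2 > 0" and "k < K"
  shows "0 \<le> rate K h \<sigma> S k"
proof -
  have "0 < (\<Sum>j\<in>{..<K} - {k}. rx_power (S j) (h j k)) + (\<sigma> k)\<^sup>2"
    using assms(1-3) by (rule interference_pos)
  moreover have "0 \<le> rx_power (S k) (h k k)"
    using assms(1,2,4) rx_power_nonneg by blast
  ultimately show ?thesis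
    using log_one_plus_divide_mono[of 0 "rx_power (S k) (h k k)"] by (force simp: rate_def)
qed

text \<open>As \<open>i \<noteq> k\<close>, the useful signal at receiver \<open>i\<close> is
  untouched. Only the summand \<open>j = k\<close> of the interference changes, and it does not
  grow.\<close>

lemma rate_fun_upd_mono:
  assumes "\<And>j. j < K \<Longrightarrow> covariance (M j) (P j) (S j)"
    and "\<And>j. j < K \<Longrightarrow> h j i \<in> carrier_vec (M j)"
    and "(\<sigma> i)\<^sup>2 > 0" and "i < K" and "i \<noteq> k"
    and "covariance (M k) (P k) T" and "rx_power T (h k i) \<le> rx_power (S k) (h k i)"
  shows "rate K h \<sigma> S i \<le> rate K h \<sigma> (S(k := T)) i"
proof -
  let ?I = "\<lambda>S. (\<Sum>j\<in>{..<K} - {i}. rx_power (S j) (h j i)) + (\<sigma> i)\<^sup>2"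
  \<comment> \<open>The updated family gives the smaller denominator, so positivity is established
    there.\<close>
  have "0 < ?I (S(k := T))"
    by (rule interference_pos[where M = M and P = P]) (use assms in auto)
  moreover have "?I (S(k := T)) \<le> ?I S"
    by (intro add_right_mono sum_mono) (use assms(7) in auto)
  moreover have "0 \<le> rx_power (S i) (h i i)"
    using assms(1,2,4) rx_power_nonneg by blast
  ultimately show ?thesis
    using \<open>i \<noteq> k\<close> unfolding rate_def by (intro log_one_plus_divide_mono) auto
qed

text \<open>The interference sum at receiver \<open>k\<close> skips \<open>j = k\<close>, so it does
  not see the update. This serves both for a competitor \<open>T\<close> and, with
  \<open>T = S k\<close>, for the original family.\<close>

lemma ic_objective_eq_rate_fun_upd:
  assumes "\<And>j. j < K \<Longrightarrow> j \<noteq> k \<Longrightarrow> \<Gamma> j k = rx_power (S j) (h j k)"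
  shows "ic_objective K h \<sigma> \<Gamma> k T = rate K h \<sigma> (S(k := T)) k"
proof -
  have "(\<Sum>j\<in>{..<K} - {k}. \<Gamma> j k) = (\<Sum>j\<in>{..<K} - {k}. rx_power ((S(k := T)) j) (h j k))"
    by (rule sum.cong) (use assms in auto)
  then show ?thesis by (simp add: ic_objective_def rate_def)
qed

text \<open>With equality in all upper bounds of the region, what remains to check is that the rates
  are nonnegative.\<close>

lemma rate_vec_mem_rate_region:
  assumes "\<And>k. k < K \<Longrightarrow> covariance (M k) (P k) (S k)"
    and "\<And>k j. k < K \<Longrightarrow> j < K \<Longrightarrow> h k j \<in> carrier_vec (M k)"
    and "\<And>k. k < K \<Longrightarrow> (\<sigma> k)\<^sup>2 > 0"
  shows "vec K (rate K h \<sigma> S) \<in> rate_region K M h \<sigma> P"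
proof -
  have "\<forall>k<K. 0 \<le> rate K h \<sigma> S k"
    using assms by (auto intro!: rate_nonneg[where M = M and P = P])
  with assms(1) show ?thesis
    by (auto simp: rate_region_def intro!: exI[of _ S])
qed

theorem proposition3p2:
  fixes K :: nat and M :: "nat \<Rightarrow> nat"
    and h :: "nat \<Rightarrow> nat \<Rightarrow> complex vec"
    and \<sigma> P :: "nat \<Rightarrow> real"
    and S :: "nat \<Rightarrow> complex mat"
    and R :: "real vec"
    and \<Gamma> :: "nat \<Rightarrow> nat \<Rightarrow> real"
  assumes "\<And>k. k < K \<Longrightarrow> M k \<ge> 1"
    and "\<And>k j. k < K \<Longrightarrow> j < K \<Longrightarrow> h k j \<in> carrier_vec (M k)"
    and "\<And>k. k < K \<Longrightarrow> (\<sigma> k)\<^sup>2 > 0"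
    and "\<And>k. k < K \<Longrightarrow> P k > 0"
    and "pareto_optimal (rate_region K M h \<sigma> P) R"
    and "\<And>k. k < K \<Longrightarrow> covariance (M k) (P k) (S k)"
    and "\<And>k. k < K \<Longrightarrow> R $ k = rate K h \<sigma> S k"
    and "\<And>k j. k < K \<Longrightarrow> j < K \<Longrightarrow> j \<noteq> k \<Longrightarrow> \<Gamma> k j = rx_power (S k) (h k j)"
  shows "(\<forall>k<K. \<forall>j<K. j \<noteq> k \<longrightarrow> \<Gamma> k j \<ge> 0)
    \<and> (\<forall>k<K. R $ k = ic_capacity K M h \<sigma> P \<Gamma> k
          \<and> is_arg_max (ic_objective K h \<sigma> \<Gamma> k) (ic_feasible K M h P \<Gamma> k) (S k)
          \<and> ic_objective K h \<sigma> \<Gamma> k (S k) = ic_capacity K M h \<sigma> P \<Gamma> k)"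
proof -
  note h = assms(2) and noise = assms(3) and cov = assms(6) and rate = assms(7) and \<Gamma> = assms(8)
  have \<Gamma>_nonneg: "\<Gamma> k j \<ge> 0" if "k < K" "j < K" "j \<noteq> k" for k j
    using rx_power_nonneg[OF cov h] \<Gamma> that by simp
  have feasible: "ic_feasible K M h P \<Gamma> k (S k)" if "k < K" for k
    using \<Gamma> cov that by (simp add: ic_feasible_def)
  have objective: "ic_objective K h \<sigma> \<Gamma> k T = rate K h \<sigma> (S(k := T)) k" if "k < K" for k T
    using \<Gamma> that by (intro ic_objective_eq_rate_fun_upd) auto
  have R_objective: "R $ k = ic_objective K h \<sigma> \<Gamma> k (S k)" if "k < K" for k
    using objective[OF that, of "S k"] rate[OF that] by simp
  \<comment> \<open>The order on vectors includes equality of dimensions, so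
    \<open>R \<le> ?R'\<close> below needs this.\<close>
  have dim_R: "R \<in> carrier_vec K"
    using assms(5) by (auto simp: pareto_optimal_def rate_region_def)
  have optimal: "ic_objective K h \<sigma> \<Gamma> k T \<le> ic_objective K h \<sigma> \<Gamma> k (S k)"
    if k: "k < K" and T: "ic_feasible K M h P \<Gamma> k T" for k T
  proof (rule ccontr)
    assume "\<not> ?thesis"
    then have better: "R $ k < rate K h \<sigma> (S(k := T)) k"
      using objective[OF k, of T] R_objective[OF k] by simp
    let ?R' = "vec K (rate K h \<sigma> (S(k := T)))"
    have covT: "covariance (M k) (P k) T"
      using T by (simp add: ic_feasible_def)
    have "?R' \<in> rate_region K M h \<sigma> P"
      by (rule rate_vec_mem_rate_region) (use cov covT h noise in auto)
    moreover have "R $ i \<le> ?R' $ i" if i: "i < K" for i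
    proof (cases "i = k")
      case True
      then show ?thesis using better i by simp
    next
      case False
      have "rate K h \<sigma> S i \<le> rate K h \<sigma> (S(k := T)) i"
      proof (rule rate_fun_upd_mono[where M = M and P = P])
        \<comment> \<open>The choice of \<Gamma> enters here: the cap that feasibility puts on
          \<open>T\<close> at receiver \<open>i\<close> is exactly the power that \<open>S k\<close>
          causes there.\<close>
        show "rx_power T (h k i) \<le> rx_power (S k) (h k i)"
          using T \<Gamma>[OF k i False] i False by (auto simp: ic_feasible_def)
      qed (use cov covT h noise i False in auto)
      then show ?thesis using rate[OF i] i by simp
    qed
    then have "R \<le> ?R'"
      using dim_R by (auto simp: less_eq_vec_def)
    \<comment> \<open>The two tuples differ in coordinate \<open>k\<close>, by the strict gain
      \<open>better\<close>.\<close>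
    moreover have "?R' \<noteq> R"
      using better k by (metis index_vec less_irrefl)
    ultimately show False
      using assms(5) by (auto simp: pareto_optimal_def)
  qed
  \<comment> \<open>The supremum is attained at \<open>S k\<close>, so it is a genuine maximum and
    no separate boundedness argument arises.\<close>
  have capacity: "ic_capacity K M h \<sigma> P \<Gamma> k = ic_objective K h \<sigma> \<Gamma> k (S k)" if "k < K" for k
    unfolding ic_capacity_def
    by (rule cSup_eq_maximum) (use feasible optimal that in auto)
  have "is_arg_max (ic_objective K h \<sigma> \<Gamma> k) (ic_feasible K M h P \<Gamma> k) (S k)" if "k < K" for k
    using feasible optimal that by (simp add: is_arg_max_linorder)
  with \<Gamma>_nonneg R_objective capacity show ?thesis by simp
qed

end
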